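(* Let $(b_j)_{j\ge 1}$, $b_j\in\{-1,1\}$, be a bit sequence produced by the leaky golden ratio encoder (GRE) with input $x=0$ (see context), let $\gamma=\frac{-\lambda_1+\sqrt{\lambda_1^2+4\lambda_1\lambda_2}}{2\lambda_1\lambda_2}$ be the associated base, and for $n\ge 0$ put $P_n(t)=b_1+\sum_{j=1}^{n}b_{j+1}t^j$. Suppose that for some $\epsilon>0$ it is known that $\gamma\le\gamma_{high}:=.6491-\epsilon$. Let $\delta>0$ be such that $\delta$-transversality holds on the interval $[0,\gamma_{high}]$. Let $N$ be the smallest integer such that $\gamma^{N+1}\le(1-\gamma)\,\epsilon\,\delta$. Then for all $n\ge N$: (a) $P_n$ has a unique root $\gamma_n$ in $[0,.6491]$; (b) $|\gamma-\gamma_n|\le C_1\gamma^n$, where $C_1=\frac{\gamma}{\delta(1-\gamma)}$.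
   Context: $\delta$-transversality: for $\delta>0$ and an interval $I\subset[0,1)$, $\delta$-transversality holds on $I$ if for every $g$ of the form $g(x)=1+\sum_{j=1}^\infty c_jx^j$ with $c_j\in\{-1,0,1\}$ and every $x\in I$: $g(x)<\delta$ implies $g'(x)<-\delta$. Leaky GRE: fix leakage parameters $(\lambda_1,\lambda_2)\in[.9,1]^2$. With input $x\in[-1,1]$, set $u_0=0$, $u_1=x$, and for $n\ge0$ let $\beta_n=Q(\lambda_1\lambda_2u_n,\lambda_1u_{n+1})\in\{-1,1\}$ and $u_{n+2}=\lambda_1\lambda_2u_n+\lambda_1u_{n+1}-\beta_n$. Here $Q=Q_\alpha^\nu$ is a "flaky" quantizer: $Q_\alpha^\nu(u,v)=-1$ if $u+\alpha v<-\nu$, $=1$ if $u+\alpha v>\nu$, and is an arbitrary element of $\{-1,1\}$ if $-\nu\le u+\alpha v\le\nu$. It is assumed that, for some tolerance $0\le\tau\le.337$, $0\le\nu\le\tau$ at each occurrence and $\alpha\in[1.198+1.479\tau,\,2.053-1.058\tau]$. The bit sequence is indexed from $1$: $b_j:=\beta_{j-1}$, $j\ge1$. *)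

theory Defs
  imports "HOL-Analysis.Analysis"
begin

definition trans_series :: "(nat \<Rightarrow> real) \<Rightarrow> real \<Rightarrow> real" where
  "trans_series c x = 1 + (\<Sum>j. c (Suc j) * x ^ Suc j)"

(* Meant for \<delta> > 0 and intervals I \<subseteq> [0,1), where the series converges. *)
definition delta_transversality :: "real \<Rightarrow> real set \<Rightarrow> bool" where
  "delta_transversality \<delta> I \<longleftrightarrow>
     (\<forall>c. (\<forall>j\<ge>1. c j \<in> {-1, 0, 1}) \<longrightarrow>
        (\<forall>x\<in>I. trans_series c x < \<delta> \<longrightarrow> deriv (trans_series c) x < -\<delta>))"

(* The flaky quantizer is not a function: flaky_quantizer \<alpha> \<nu> u v q says that q is an
   admissible output of Q on input (u, v). *)
definition flaky_quantizer :: "real \<Rightarrow> real \<Rightarrow> real \<Rightarrow> real \<Rightarrow> real \<Rightarrow> bool" where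
  "flaky_quantizer \<alpha> \<nu> u v q \<longleftrightarrow>
     q \<in> {-1, 1} \<and>
     (u + \<alpha> * v < -\<nu> \<longrightarrow> q = -1) \<and>
     (u + \<alpha> * v > \<nu> \<longrightarrow> q = 1)"

(* \<nu> n is the flakiness at step n; it may change from step to step. *)
definition leaky_gre ::
  "real \<Rightarrow> real \<Rightarrow> real \<Rightarrow> (nat \<Rightarrow> real) \<Rightarrow> real \<Rightarrow> (nat \<Rightarrow> real) \<Rightarrow> (nat \<Rightarrow> real) \<Rightarrow> bool" where
  "leaky_gre l1 l2 \<alpha> \<nu> x u \<beta> \<longleftrightarrow>
     u 0 = 0 \<and> u 1 = x \<and>
     (\<forall>n. flaky_quantizer \<alpha> (\<nu> n) (l1 * l2 * u n) (l1 * u (n + 1)) (\<beta> n) \<and>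
          u (n + 2) = l1 * l2 * u n + l1 * u (n + 1) - \<beta> n)"

definition gre_base :: "real \<Rightarrow> real \<Rightarrow> real" where
  "gre_base l1 l2 = (- l1 + sqrt (l1\<^sup>2 + 4 * l1 * l2)) / (2 * l1 * l2)"

definition gre_poly :: "(nat \<Rightarrow> real) \<Rightarrow> nat \<Rightarrow> real \<Rightarrow> real" where
  "gre_poly b n t = b 1 + (\<Sum>j=1..n. b (j + 1) * t ^ j)"

end

theory Submission
  imports Defs
begin

text \<open>
  Transversality enters only through an upper bound on \<open>\<delta>\<close>: testing it at \<open>x = 0.618 \<le> \<gamma>\<close> with the
  series \<open>1 - x - x^2 - x^3 + x^4 + x^5 + ...\<close> gives \<open>\<delta> \<le> 0.146\<close>.  The slope estimate itself comes
  from the encoder.  With input \<open>0\<close> and up to a global sign, its bits start with \<open>1, -1, -1\<close>, and the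
  next two cannot be \<open>-1, -1\<close>; for such a polynomial \<open>p\<close> one has \<open>5 p(x) - x p'(x) \<ge> 0.16\<close> on all of
  \<open>[0, 0.6491]\<close>, so that \<open>p(x) \<le> \<epsilon> \<delta>\<close> forces \<open>p'(x) < - \<delta>\<close>, also beyond \<open>\<gamma>high\<close>.  Boundedness of the
  encoder state gives \<open>\<bar>p(\<gamma>)\<bar> \<le> \<gamma>^(n+1) / (1 - \<gamma>) \<le> \<epsilon> \<delta>\<close>, and following the slope from \<open>\<gamma>\<close> yields
  the root and the error bound.
\<close>

section \<open>Roots of functions that fall steeply wherever they are small\<close>

text \<open>At the last point before \<open>y\<close> where \<open>f\<close> is at most
  \<open>h\<close>, the negative derivative keeps \<open>f\<close> below \<open>h\<close> a little
  further to the right, so that point cannot lie before \<open>y\<close>.\<close>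

lemma stays_below:
  fixes f f' :: "real \<Rightarrow> real"
  assumes deriv: "\<And>x. (f has_real_derivative f' x) (at x)"
    and neg: "\<And>x. a \<le> x \<Longrightarrow> x \<le> B \<Longrightarrow> f x \<le> h \<Longrightarrow> f' x < 0"
    and "f a \<le> h" "a \<le> y" "y \<le> B"
  shows "f y \<le> h"
proof (rule ccontr)
  assume "\<not> f y \<le> h"
  define S where "S = {t \<in> {a..y}. f t \<le> h}"
  have cont: "continuous_on {a..y} f"
    by (rule DERIV_continuous_on) (rule has_field_derivative_at_within[OF deriv])
  have "S = {a..y} \<inter> f -` {..h}"
    by (auto simp: S_def)
  then have "closed S"
    using continuous_closed_preimage[OF cont] by simp
  moreover have "bounded S"
    by (rule bounded_subset[of "{a..y}"]) (auto simp: S_def)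
  ultimately have "compact S"
    by (simp add: compact_eq_bounded_closed)
  moreover have "a \<in> S"
    using assms by (simp add: S_def)
  ultimately obtain z where z: "z \<in> S" "\<And>t. t \<in> S \<Longrightarrow> t \<le> z"
    using compact_attains_sup[of S] by blast
  have zy: "a \<le> z" "z < y" "f z \<le> h"
    using z(1) \<open>\<not> f y \<le> h\<close> by (auto simp: S_def less_le)
  then have "f' z < 0"
    using neg \<open>y \<le> B\<close> by simp
  then obtain d where d: "d > 0" "\<And>e. 0 < e \<Longrightarrow> e < d \<Longrightarrow> f (z + e) < f z"
    using DERIV_neg_dec_right[OF deriv] by blast
  define e where "e = min (d/2) (y - z)"
  have e: "0 < e" "e < d" "z + e \<le> y"
    using d(1) zy by (auto simp: e_def)
  have "f (z + e) \<le> h"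
    using d(2)[OF e(1,2)] zy(3) by linarith
  moreover have "a \<le> z + e"
    using zy(1) e(1) by linarith
  ultimately have "z + e \<in> S"
    using e(3) unfolding S_def by simp
  then show False
    using z(2)[of "z + e"] e(1) by linarith
qed

text \<open>The slope bound holds only where \<open>f\<close> is small, and the mean value theorem
  gives no control over its intermediate point; \<open>stays_below\<close> guarantees that
  \<open>f\<close> is small there.\<close>

lemma transversal_decrease:
  fixes f f' :: "real \<Rightarrow> real"
  assumes deriv: "\<And>x. (f has_real_derivative f' x) (at x)"
    and neg: "\<And>x. a \<le> x \<Longrightarrow> x \<le> B \<Longrightarrow> f x \<le> h \<Longrightarrow> f' x < - \<delta>"
    and "\<delta> > 0" "f a \<le> h" "a \<le> y" "y \<le> B"
  shows "f y \<le> f a - \<delta> * (y - a)"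
proof (cases "a = y")
  case False
  then have "a < y"
    using \<open>a \<le> y\<close> by simp
  then obtain z where z: "a < z" "z < y" "f y - f a = (y - a) * f' z"
    using MVT2[of a y f f'] deriv by blast
  have "f z \<le> h"
  proof (rule stays_below[where f = f and f' = f' and B = B and a = a])
    show "f' x < 0" if "a \<le> x" "x \<le> B" "f x \<le> h" for x
      using neg[OF that] \<open>\<delta> > 0\<close> by linarith
  qed (use z assms in auto)
  then have "f' z < - \<delta>"
    using neg z assms by simp
  then have "(y - a) * f' z \<le> (y - a) * (- \<delta>)"
    using \<open>a < y\<close> by (intro mult_left_mono) auto
  then show ?thesis
    using z(3) by (simp add: algebra_simps)
qed simp

text \<open>From a point \<open>g\<close> where \<open>f\<close> is at most \<open>k\<close>, a
  descent at rate \<open>\<delta>\<close> reaches zero within distance \<open>k / \<delta>\<close>,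
  and \<open>B\<close> leaves room for this. After a root \<open>f\<close> is strictly negative,
  hence uniqueness. Between \<open>g\<close> and a root, on either side, \<open>f\<close> changes by
  at most \<open>k\<close> and falls by at least \<open>\<delta>\<close> times the distance.\<close>

lemma transversal_root:
  fixes f f' :: "real \<Rightarrow> real"
  assumes deriv: "\<And>x. (f has_real_derivative f' x) (at x)"
    and neg: "\<And>x. 0 \<le> x \<Longrightarrow> x \<le> B \<Longrightarrow> f x \<le> h \<Longrightarrow> f' x < - \<delta>"
    and "\<delta> > 0" "0 \<le> f 0" "0 \<le> g" "\<bar>f g\<bar> \<le> k" "k \<le> h" "g + k / \<delta> \<le> B"
  shows "\<exists>!t. t \<in> {0..B} \<and> f t = 0"
    and "t \<in> {0..B} \<Longrightarrow> f t = 0 \<Longrightarrow> \<bar>g - t\<bar> \<le> k / \<delta>"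
proof -
  have dec: "f y \<le> f a - \<delta> * (y - a)" if "0 \<le> a" "a \<le> y" "y \<le> B" "f a \<le> h" for a y
  proof (rule transversal_decrease[OF deriv, where B = B and h = h])
    show "f' x < - \<delta>" if "a \<le> x" "x \<le> B" "f x \<le> h" for x
      using neg[of x] that \<open>0 \<le> a\<close> by simp
  qed (use that \<open>\<delta> > 0\<close> in auto)
  have k: "0 \<le> k" "0 \<le> h"
    using assms by linarith+
  then have "0 \<le> k / \<delta>"
    using \<open>\<delta> > 0\<close> by simp
  then have "g \<le> B"
    using assms by linarith
  note k = k \<open>0 \<le> k / \<delta>\<close> \<open>g \<le> B\<close>
  have cont: "continuous_on A f" for A
    by (rule DERIV_continuous_on) (rule has_field_derivative_at_within[OF deriv])
  have "\<exists>t. t \<in> {0..B} \<and> f t = 0"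
  proof (cases "f g \<le> 0")
    case True
    then show ?thesis
      using IVT2'[OF True \<open>0 \<le> f 0\<close> \<open>0 \<le> g\<close> cont] k by force
  next
    case False
    have "f (g + k / \<delta>) \<le> f g - k"
      using dec[of g "g + k / \<delta>"] assms(3-) k by simp
    then have "f (g + k / \<delta>) \<le> 0"
      using assms(6) by linarith
    moreover have "0 \<le> f g" "g \<le> g + k / \<delta>"
      using False k by auto
    ultimately obtain t where "g \<le> t" "t \<le> g + k / \<delta>" "f t = 0"
      using IVT2'[OF _ _ _ cont] by blast
    then show ?thesis
      using assms(5,8) by (intro exI[of _ t]) auto
  qed
  moreover have "t = t'" if "t \<in> {0..B}" "f t = 0" "t' \<in> {0..B}" "f t' = 0" for t t'
  proof -
    have "\<not> t < t'" if "t \<in> {0..B}" "f t = 0" "t' \<in> {0..B}" "f t' = 0" for t t'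
      using dec[of t t'] that k(2) \<open>\<delta> > 0\<close> by (auto simp: mult_le_0_iff)
    then show ?thesis
      using that by (meson linorder_cases)
  qed
  ultimately show "\<exists>!t. t \<in> {0..B} \<and> f t = 0"
    by blast
  assume t: "t \<in> {0..B}" "f t = 0"
  have "\<delta> * \<bar>g - t\<bar> \<le> k"
  proof (cases "g \<le> t")
    case True
    then show ?thesis
      using dec[of g t] t assms(5-7) by (simp add: algebra_simps abs_le_iff)
  next
    case False
    then show ?thesis
      using dec[of t g] t assms(6) k by (simp add: algebra_simps)
  qed
  then show "\<bar>g - t\<bar> \<le> k / \<delta>"
    using \<open>\<delta> > 0\<close> by (simp add: pos_le_divide_eq mult.commute)
qed

section \<open>Slope of polynomials with prescribed first coefficients\<close>

lemma sum_Suc_mult_power_le: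
  fixes x :: real
  assumes "0 \<le> x" "x < 1"
  shows "(\<Sum>i<m. real (Suc i) * x ^ i) \<le> 1 / (1 - x)\<^sup>2"
proof -
  have "(\<lambda>n. real (Suc n) * x ^ n) sums (1 / (1 - x)\<^sup>2)"
    using geometric_deriv_sums[of x] assms by simp
  then show ?thesis
    using sum_le_suminf[of "\<lambda>n. real (Suc n) * x ^ n" "{..<m}"] assms
    by (auto simp: sums_iff)
qed

text \<open>
  The combination \<open>5 p - x p'\<close> has coefficients \<open>(5 - j) c j\<close>, so the sign change at
  \<open>j = 5\<close> separates the first bits, which the encoder forces, from an arbitrary tail.
\<close>
lemma slope_bound:
  fixes c :: "nat \<Rightarrow> real" and x :: real
  assumes x: "0 \<le> x" "x \<le> 6491/10000" and "n \<ge> 5"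
    and c: "\<And>j. \<bar>c j\<bar> \<le> 1" "c 0 = 1" "c 1 = -1" "c 2 = -1" "c 3 = 1 \<or> c 3 = -1 \<and> c 4 = 1"
  shows "4/25 \<le> 5 * (\<Sum>j\<le>n. c j * x ^ j) - x * (\<Sum>j\<le>n. c j * (real j * x ^ (j - 1)))"
proof -
  define d where "d j = (5 - real j) * (c j * x ^ j)" for j
  obtain m where m: "n = m + 5"
    using \<open>n \<ge> 5\<close> le_Suc_ex by (metis add.commute)
  have "5 * (\<Sum>j\<le>n. c j * x ^ j) - x * (\<Sum>j\<le>n. c j * (real j * x ^ (j - 1))) = (\<Sum>j\<le>n. d j)"
  proof -
    have "5 * (c j * x ^ j) - x * (c j * (real j * x ^ (j - 1))) = d j" for j
      by (cases j) (auto simp: d_def algebra_simps)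
    then show ?thesis
      by (simp only: sum_distrib_left sum_subtractf[symmetric])
  qed
  also have "\<dots> = (\<Sum>j<6. d j) + (\<Sum>i<m. d (i + 6))"
  proof -
    have "{..n} = {..<m + 6}"
      using m by auto
    moreover have "(\<Sum>j<k + 6. d j) = (\<Sum>j<6. d j) + (\<Sum>i<k. d (i + 6))" for k
    proof (induction k)
      case (Suc k)
      have "{..<Suc k + 6} = insert (k + 6) {..<k + 6}"
        by auto
      with Suc show ?case
        by simp
    qed simp
    ultimately show ?thesis
      by simp
  qed
  finally have eq: "5 * (\<Sum>j\<le>n. c j * x ^ j) - x * (\<Sum>j\<le>n. c j * (real j * x ^ (j - 1))) =
      (\<Sum>j<6. d j) + (\<Sum>i<m. d (i + 6))" .
  \<comment> \<open>With coefficients bounded by 1, the weights 1, 2, 3, ... from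
    \<open>j = 6\<close> on give \<open>x ^ 6\<close> times the differentiated geometric
    series.\<close>
  have "(\<Sum>i<m. d (i + 6)) \<ge> - (x ^ 6 / (1 - x)\<^sup>2)"
  proof -
    have "- (real (Suc i) * x ^ i) * x ^ 6 \<le> d (i + 6)" for i
    proof -
      have "c (i + 6) * x ^ (i + 6) \<le> 1 * x ^ (i + 6)"
        using c(1)[of "i + 6"] x by (intro mult_right_mono) auto
      then have "real (Suc i) * (c (i + 6) * x ^ (i + 6)) \<le> real (Suc i) * (1 * x ^ (i + 6))"
        by (intro mult_left_mono) auto
      then show ?thesis
        by (simp add: d_def power_add algebra_simps)
    qed
    then have "(\<Sum>i<m. - (real (Suc i) * x ^ i) * x ^ 6) \<le> (\<Sum>i<m. d (i + 6))"
      by (rule sum_mono)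
    moreover have "(\<Sum>i<m. real (Suc i) * x ^ i) * x ^ 6 \<le> 1 / (1 - x)\<^sup>2 * x ^ 6"
      using sum_Suc_mult_power_le[of x m] x by (intro mult_right_mono) auto
    ultimately show ?thesis
      by (simp add: sum_distrib_right sum_negf)
  qed
  \<comment> \<open>The term \<open>j = 5\<close> vanishes. The worst case is
    \<open>c 3 = -1\<close>, \<open>c 4 = 1\<close>: if \<open>c 3 = 1\<close>, the gain
    \<open>4 * x ^ 3\<close> outweighs a loss of at most \<open>2 * x ^ 4\<close>.\<close>
  moreover have "(\<Sum>j<6. d j) \<ge> 5 - 4 * x - 3 * x\<^sup>2 - 2 * x ^ 3 + x ^ 4"
  proof -
    have "x ^ 4 \<le> x ^ 3" using x by (intro power_decreasing) auto
    moreover have "0 \<le> x ^ 3" "0 \<le> x ^ 4" using x by auto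
    moreover have "- (x ^ 4) \<le> c 4 * x ^ 4"
      using c(1)[of 4] x mult_right_mono[of "-1" "c 4" "x ^ 4"] by auto
    ultimately show ?thesis
      using c(2-) by (auto simp: d_def numeral_eq_Suc)
  qed
  \<comment> \<open>Only \<open>x ^ 4\<close> grows with \<open>x\<close> on the left, and the
    quadratic and cubic terms absorb its growth. So it suffices to evaluate at the right endpoint
    \<open>y\<close>, where the value is about 0.163.\<close>
  moreover have "5 - 4 * x - 3 * x\<^sup>2 - 2 * x ^ 3 + x ^ 4 - x ^ 6 / (1 - x)\<^sup>2 \<ge> 4/25"
  proof -
    define y :: real where "y = 6491/10000"
    have "0 \<le> y" "x \<le> y" "y < 1"
      using x by (auto simp: y_def)
    have "x\<^sup>2 \<le> y\<^sup>2" "x ^ 3 \<le> y ^ 3" "x ^ 6 \<le> y ^ 6"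
      using x \<open>x \<le> y\<close> by (auto intro!: power_mono)
    moreover have "x ^ 6 / (1 - x)\<^sup>2 \<le> y ^ 6 / (1 - y)\<^sup>2"
      using x \<open>x \<le> y\<close> \<open>y < 1\<close> by (intro frac_le power_mono) auto
    moreover have "y ^ 4 - x ^ 4 \<le> 2 * (y ^ 3 - x ^ 3) + 3 * (y\<^sup>2 - x\<^sup>2)"
    proof -
      have "y ^ 4 - x ^ 4 = (y\<^sup>2 - x\<^sup>2) * (y\<^sup>2 + x\<^sup>2)"
        by (simp add: algebra_simps power2_eq_square power4_eq_xxxx)
      also have "\<dots> \<le> (y\<^sup>2 - x\<^sup>2) * 3"
      proof (intro mult_left_mono)
        have "y\<^sup>2 \<le> 1" by (simp add: y_def power_divide)
        then show "y\<^sup>2 + x\<^sup>2 \<le> 3" using \<open>x\<^sup>2 \<le> y\<^sup>2\<close> by linarith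
      qed (use \<open>x\<^sup>2 \<le> y\<^sup>2\<close> in simp)
      finally show ?thesis
        using \<open>x ^ 3 \<le> y ^ 3\<close> by (simp add: algebra_simps)
    qed
    moreover have "5 - 4 * y - 3 * y\<^sup>2 - 2 * y ^ 3 + y ^ 4 - y ^ 6 / (1 - y)\<^sup>2 \<ge> 4/25"
      by (simp add: y_def power_divide)
    \<comment> \<open>Powers and quotients are replaced by variables, which leaves a linear
      problem.\<close>
    moreover have "p \<le> q \<Longrightarrow> c \<le> 5 - 4 * y - 3 * y2 - 2 * y3 + y4 - q \<Longrightarrow> x2 \<le> y2 \<Longrightarrow>
        y4 - x4 \<le> 2 * (y3 - x3) + 3 * (y2 - x2) \<Longrightarrow> c \<le> 5 - 4 * x - 3 * x2 - 2 * x3 + x4 - p"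
      for p q c x2 y2 x3 y3 x4 y4 :: real
      using \<open>x \<le> y\<close> by argo
    ultimately show ?thesis
      by blast
  qed
  ultimately show ?thesis
    unfolding eq by linarith
qed

section \<open>Upper bound on the transversality constant\<close>

text \<open>The test series has the closed form \<open>G\<close> on (-1, 1). At 0.618 its derivative
  is positive, about 0.089, so transversality forces its value there, about 0.1459, to be at least
  \<open>\<delta>\<close>.\<close>

lemma delta_transversality_le:
  assumes tr: "delta_transversality \<delta> I" and "309/500 \<in> I"
  shows "\<delta> \<le> 73/500"
proof (rule ccontr)
  assume \<delta>: "\<not> \<delta> \<le> 73/500"
  define c :: "nat \<Rightarrow> real" where "c j = (if j \<le> 3 then -1 else 1)" for j
  define G :: "real \<Rightarrow> real" where "G x = 1 / (1 - x) - 2 * (x + x\<^sup>2 + x ^ 3)" for x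
  have ts: "trans_series c x = G x" if "\<bar>x\<bar> < 1" for x
  proof -
    have "(\<lambda>j. x * x ^ j) sums (x * (1 / (1 - x)))"
      using that by (intro sums_mult geometric_sums) auto
    moreover have "(\<lambda>j. if j \<in> {..<3} then - (2 * x ^ Suc j) else 0) sums (\<Sum>j<3. - (2 * x ^ Suc j))"
      by (rule sums_If_finite_set) simp
    ultimately have "(\<lambda>j. x * x ^ j + (if j \<in> {..<3} then - (2 * x ^ Suc j) else 0))
        sums (x * (1 / (1 - x)) + (\<Sum>j<3. - (2 * x ^ Suc j)))"
      by (rule sums_add)
    moreover have "(\<lambda>j. x * x ^ j + (if j \<in> {..<3} then - (2 * x ^ Suc j) else 0)) = (\<lambda>j. c (Suc j) * x ^ Suc j)"
      by (auto simp: c_def)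
    ultimately have "(\<Sum>j. c (Suc j) * x ^ Suc j) = x * (1 / (1 - x)) + (\<Sum>j<3. - (2 * x ^ Suc j))"
      by (simp add: sums_iff)
    moreover have "1 + x * (1 / (1 - x)) = 1 / (1 - x)"
      using that by (simp add: field_simps)
    ultimately show ?thesis
      by (simp add: trans_series_def G_def numeral_eq_Suc algebra_simps)
  qed
  let ?x = "309/500 :: real"
  define D where "D = 1 / (1 - ?x)\<^sup>2 - 2 * (1 + 2 * ?x + 3 * ?x\<^sup>2)"
  have "(G has_real_derivative D) (at ?x)"
    unfolding G_def D_def by (auto intro!: derivative_eq_intros simp: power2_eq_square field_simps)
  then have "(trans_series c has_real_derivative D) (at ?x)"
    by (rule has_field_derivative_transform_within_open[where S = "{-1<..<1}"]) (auto simp: ts)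
  then have "deriv (trans_series c) ?x = D"
    by (rule DERIV_imp_deriv)
  moreover have "D > 0"
    by (simp add: D_def power_divide)
  moreover have "trans_series c ?x < \<delta>"
  proof -
    have "trans_series c ?x = G ?x" by (rule ts) simp
    also have "\<dots> \<le> 73/500" by (simp add: G_def power_divide)
    finally show ?thesis using \<delta> by simp
  qed
  moreover have "\<forall>j\<ge>1. c j \<in> {-1, 0, 1}"
    by (simp add: c_def)
  ultimately have "D < - \<delta>"
    using tr \<open>309/500 \<in> I\<close> unfolding delta_transversality_def by metis
  then show False
    using \<open>D > 0\<close> \<delta> by simp
qed

section \<open>The base equation and identities of the encoder\<close>

lemma gre_base_root:
  assumes "l1 > 0" "l2 > 0"
  shows "gre_base l1 l2 > 0" "l1 * l2 * (gre_base l1 l2)\<^sup>2 + l1 * gre_base l1 l2 = 1"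
proof -
  define r where "r = sqrt (l1\<^sup>2 + 4 * l1 * l2)"
  have r2: "r\<^sup>2 = l1\<^sup>2 + 4 * l1 * l2"
    using assms by (simp add: r_def)
  have "l1 = sqrt (l1\<^sup>2)" using assms by simp
  also have "\<dots> < r" unfolding r_def using assms by (intro real_sqrt_less_mono) simp
  finally show "gre_base l1 l2 > 0"
    using assms by (simp add: gre_base_def r_def)
  have "gre_base l1 l2 = (r - l1) / (2 * l1 * l2)"
    by (simp add: gre_base_def r_def)
  then have *: "2 * l1 * l2 * gre_base l1 l2 = r - l1"
    using assms by simp
  have "4 * l1 * l2 * (l1 * l2 * (gre_base l1 l2)\<^sup>2 + l1 * gre_base l1 l2)
      = (2 * l1 * l2 * gre_base l1 l2)\<^sup>2 + 2 * l1 * (2 * l1 * l2 * gre_base l1 l2)"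
    by (simp add: power2_eq_square algebra_simps)
  also have "\<dots> = 4 * l1 * l2 * 1"
    unfolding * using r2 by (simp add: power2_eq_square algebra_simps)
  finally show "l1 * l2 * (gre_base l1 l2)\<^sup>2 + l1 * gre_base l1 l2 = 1"
    using assms by simp
qed

text \<open>The two thresholds of the quantizer are symmetric about 0. This allows the first bit to
  be normalised to 1.\<close>

lemma leaky_gre_uminus:
  assumes "leaky_gre l1 l2 \<alpha> \<nu> x u \<beta>"
  shows "leaky_gre l1 l2 \<alpha> \<nu> (- x) (\<lambda>n. - u n) (\<lambda>n. - \<beta> n)"
proof -
  have "flaky_quantizer \<alpha> \<nu>' (- y) (- z) (- q)" if "flaky_quantizer \<alpha> \<nu>' y z q" for \<nu>' y z q
    using that unfolding flaky_quantizer_def by auto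
  then show ?thesis
    using assms unfolding leaky_gre_def by simp
qed

text \<open>The equation for \<open>g\<close> makes the sum telescope: each bit term is the
  difference of two successive values of the remainder on the right.\<close>

lemma leaky_gre_sums:
  assumes gre: "leaky_gre l1 l2 \<alpha> \<nu> x u \<beta>"
    and g: "l1 * l2 * g\<^sup>2 + l1 * g = 1"
  shows "(\<Sum>j<n. \<beta> j * g ^ Suc j) = x - g ^ n * (u (Suc n) + l1 * l2 * g * u n)"
proof (induction n)
  case 0
  then show ?case
    using gre by (simp add: leaky_gre_def)
next
  case (Suc n)
  have "u (Suc (Suc n)) = l1 * l2 * u n + l1 * u (Suc n) - \<beta> n"
    using gre by (simp add: leaky_gre_def)
  then have "g ^ Suc n * (u (Suc (Suc n)) + l1 * l2 * g * u (Suc n)) + \<beta> n * g ^ Suc n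
      = g ^ n * ((l1 * l2 * g\<^sup>2 + l1 * g) * u (Suc n) + l1 * l2 * g * u n)"
    by (simp add: power2_eq_square distrib_left distrib_right right_diff_distrib left_diff_distrib mult_ac)
  then show ?case
    using Suc unfolding g by simp
qed

section \<open>First bits for zero input\<close>

text \<open>The orbit starts 0, 0, -1, \<open>1 - l1\<close>, and the quantizer argument exceeds the
  largest tolerance 0.337 in modulus whenever a bit is claimed to be forced. The bounds on
  \<open>\<alpha>\<close> are those for \<open>\<tau> = 0\<close>, the widest range. The bit
  \<open>\<beta> 3\<close> is free, but -1 pushes \<open>u 5\<close> up to at least 1.\<close>

lemma leaky_gre_initial_bits:
  assumes gre: "leaky_gre l1 l2 \<alpha> \<nu> 0 u \<beta>"
    and l: "9/10 \<le> l1" "l1 \<le> 1" "9/10 \<le> l2" "l2 \<le> 1"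
    and \<nu>: "\<And>k. \<nu> k \<le> 337/1000" and \<alpha>: "599/500 \<le> \<alpha>" "\<alpha> \<le> 2053/1000"
    and "\<beta> 0 = 1"
  shows "\<beta> 1 = -1" "\<beta> 2 = -1" "\<beta> 3 = 1 \<or> \<beta> 3 = -1 \<and> \<beta> 4 = 1"
proof -
  have neg: "\<beta> n = -1" if "l1 * l2 * u n + \<alpha> * (l1 * u (n + 1)) < - (337/1000)" for n
    using gre \<nu>[of n] that unfolding leaky_gre_def flaky_quantizer_def by force
  have pos: "\<beta> n = 1" if "l1 * l2 * u n + \<alpha> * (l1 * u (n + 1)) > 337/1000" for n
    using gre \<nu>[of n] that unfolding leaky_gre_def flaky_quantizer_def by force
  have bit: "\<beta> n = 1 \<or> \<beta> n = -1" for n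
    using gre by (auto simp: leaky_gre_def flaky_quantizer_def)
  have rec: "u (n + 2) = l1 * l2 * u n + l1 * u (n + 1) - \<beta> n" for n
    using gre by (simp add: leaky_gre_def)
  have al: "107/100 \<le> \<alpha> * l1" "\<alpha> * l1 \<le> 2053/1000"
    using mult_mono[of "599/500" \<alpha> "9/10" l1] mult_mono[of \<alpha> "2053/1000" l1 1] l \<alpha> by auto
  have ll: "81/100 \<le> l1 * l2" "l1 * l2 \<le> 1"
    using mult_mono[of "9/10" l1 "9/10" l2] mult_mono[of l1 1 l2 1] l by auto
  have u: "u 0 = 0" "u 1 = 0"
    using gre by (auto simp: leaky_gre_def)
  have u2: "u 2 = -1"
    using rec[of 0] u \<open>\<beta> 0 = 1\<close> by (simp add: numeral_eq_Suc)
  show b1: "\<beta> 1 = -1"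
    using neg[of 1] u u2 al by (simp add: numeral_eq_Suc)
  have u3: "u 3 = 1 - l1"
    using rec[of 1] u u2 b1 by (simp add: numeral_eq_Suc)
  have "\<alpha> * l1 * (1 - l1) \<le> 2053/1000 * (1/10)"
    using l al by (intro mult_mono) auto
  then have "l1 * l2 * u 2 + \<alpha> * (l1 * u 3) < - (337/1000)"
    unfolding u2 u3 mult.assoc[symmetric] using ll by linarith
  then show b2: "\<beta> 2 = -1"
    using neg[of 2] by simp
  have "u 4 = l1 * l2 * u 2 + l1 * u 3 - \<beta> 2"
    using rec[of 2] by (simp add: numeral_eq_Suc)
  then have u4: "u 4 = 1 + l1 * (1 - l1 - l2)"
    unfolding u2 u3 b2 by (simp add: algebra_simps)
  have "l1 * (l1 + l2 - 1) \<le> 1 * 1"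
    using l by (intro mult_mono) auto
  then have u4_nonneg: "0 \<le> u 4"
    unfolding u4 by (simp add: algebra_simps)
  have "\<beta> 4 = 1" if "\<beta> 3 = -1"
  proof -
    have "u 5 = l1 * l2 * u 3 + l1 * u 4 + 1"
      using rec[of 3] that by (simp add: numeral_eq_Suc)
    moreover have "0 \<le> l1 * l2 * u 3" "0 \<le> l1 * u 4"
      using l u3 u4_nonneg by auto
    ultimately have "1 \<le> u 5"
      by linarith
    then have "107/100 * 1 \<le> \<alpha> * l1 * u 5"
      using al by (intro mult_mono) auto
    moreover have "0 \<le> l1 * l2 * u 4"
      using l u4_nonneg by auto
    ultimately have "l1 * l2 * u 4 + \<alpha> * (l1 * u 5) > 337/1000"
      by (simp add: algebra_simps)
    then show ?thesis
      using pos[of 4] by simp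
  qed
  then show "\<beta> 3 = 1 \<or> \<beta> 3 = -1 \<and> \<beta> 4 = 1"
    using bit[of 3] by blast
qed

section \<open>Boundedness of the encoder state\<close>

text \<open>If the bit 1 is emitted, the expanding coordinate \<open>w = v + s * u\<close> becomes
  \<open>\<theta> * w - 1\<close>; the conclusion says that this is at least
  \<open>- 1 / (\<theta> - 1)\<close>. The quantizer argument is a combination of \<open>w\<close>
  and the contracting coordinate \<open>y\<close>, which is bounded, so admitting the bit 1 bounds
  \<open>w\<close> from below.\<close>

lemma leaky_gre_step:
  fixes s \<theta> a \<tau> u v :: real
  assumes \<theta>: "77/50 \<le> \<theta>" "\<theta> \<le> 8091/5000" and s: "14/25 \<le> s" "s \<le> 6181/10000"
    and \<tau>: "0 \<le> \<tau>" "\<tau> \<le> 337/1000"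
    and a: "107/100 + 133/100 * \<tau> \<le> a" "a \<le> 2053/1000 - 1058/1000 * \<tau>"
    and z: "(1 - s) * \<bar>v - \<theta> * u\<bar> \<le> 1"
    and q: "- \<tau> \<le> s * \<theta> * u + a * v"
  shows "\<theta> - 2 \<le> (\<theta> - 1) * (\<theta> * (v + s * u))"
proof -
  define w where "w = v + s * u"
  define y where "y = v - \<theta> * u"
  have pos: "0 < a + s"
    using a \<tau> s by linarith
  have "\<bar>y\<bar> \<le> 1 / (1 - s)"
    using z s by (simp add: y_def pos_le_divide_eq mult.commute)
  then have "s * \<bar>y\<bar> \<le> s * (1 / (1 - s))"
    using s by (intro mult_left_mono) auto
  also have "\<dots> \<le> 16185/10000"
    using s by (simp add: divide_le_eq)
  finally have "s * \<bar>y\<bar> * \<bar>\<theta> - a\<bar> \<le> 16185/10000 * \<bar>\<theta> - a\<bar>"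
    by (intro mult_right_mono) auto
  moreover have "- (s * \<bar>y\<bar> * \<bar>\<theta> - a\<bar>) \<le> s * (\<theta> - a) * y"
    using abs_ge_minus_self[of "s * (\<theta> - a) * y"] s by (simp add: abs_mult mult_ac)
  moreover have "- (22363/10000 * \<tau>) \<le> (s + \<theta>) * (s * \<theta> * u + a * v)"
  proof -
    have "(s + \<theta>) * \<tau> \<le> 22363/10000 * \<tau>"
      using s \<theta> \<tau> by (intro mult_right_mono) auto
    moreover have "(s + \<theta>) * (- \<tau>) \<le> (s + \<theta>) * (s * \<theta> * u + a * v)"
      using q s \<theta> by (intro mult_left_mono) auto
    ultimately show ?thesis
      by simp
  qed
  moreover have "(s + \<theta>) * (s * \<theta> * u + a * v) = \<theta> * (a + s) * w - s * (\<theta> - a) * y"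
    by (simp add: w_def y_def algebra_simps)
  moreover have "22363/10000 * \<tau> + 16185/10000 * \<bar>\<theta> - a\<bar> \<le> 617/1000 * (a + s)"
  proof (cases "a \<le> \<theta>")
    case True
    then have "\<bar>\<theta> - a\<bar> = \<theta> - a"
      by simp
    then show ?thesis
      using \<theta>(2) s(1) \<tau>(1) a(1) by argo
  next
    case False
    then have "\<bar>\<theta> - a\<bar> = a - \<theta>"
      by simp
    then show ?thesis
      using \<theta>(1) s(1) \<tau>(2) a(2) by argo
  qed
  ultimately have "- (617/1000 * (a + s)) \<le> \<theta> * (a + s) * w"
    by linarith
  then have "(\<theta> - 1) * (- (617/1000 * (a + s))) \<le> (\<theta> - 1) * (\<theta> * (a + s) * w)"
    using \<theta> by (intro mult_left_mono) auto
  moreover have "(\<theta> - 1) * (617/1000) * (a + s) \<le> (2 - \<theta>) * (a + s)"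
    using \<theta> pos by (intro mult_right_mono) auto
  ultimately have "(a + s) * (\<theta> - 2) \<le> (a + s) * ((\<theta> - 1) * (\<theta> * w))"
    by (simp add: algebra_simps)
  then show ?thesis
    using pos by (simp add: w_def)
qed

text \<open>
  The matrix of the recursion has eigenvalues \<open>\<theta> = 1 / \<gamma>\<close> and \<open>- s\<close>; the two bounded quantities
  are the coordinates of the state with respect to its left eigenvectors.
\<close>
lemma leaky_gre_bounded:
  assumes gre: "leaky_gre l1 l2 \<alpha> \<nu> 0 u \<beta>"
    and l1: "9/10 \<le> l1" "l1 \<le> 1" and s\<theta>: "s * \<theta> = l1 * l2" "\<theta> - s = l1"
    and \<theta>: "77/50 \<le> \<theta>" "\<theta> \<le> 8091/5000" and s: "14/25 \<le> s" "s \<le> 6181/10000"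
    and \<tau>: "0 \<le> \<tau>" "\<tau> \<le> 337/1000" and \<nu>: "\<And>k. \<nu> k \<le> \<tau>"
    and \<alpha>: "1198/1000 + 1479/1000 * \<tau> \<le> \<alpha>" "\<alpha> \<le> 2053/1000 - 1058/1000 * \<tau>"
  shows "(\<theta> - 1) * \<bar>u (Suc n) + s * u n\<bar> \<le> 1 \<and> (1 - s) * \<bar>u (Suc n) - \<theta> * u n\<bar> \<le> 1"
proof (induction n)
  case 0
  then show ?case
    using gre by (simp add: leaky_gre_def)
next
  case (Suc n)
  define w where "w = u (Suc n) + s * u n"
  define z where "z = u (Suc n) - \<theta> * u n"
  have quantizer: "flaky_quantizer \<alpha> (\<nu> n) (l1 * l2 * u n) (l1 * u (Suc n)) (\<beta> n)"
    using gre by (simp add: leaky_gre_def)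
  then have bit: "\<beta> n = 1 \<or> \<beta> n = -1"
    by (auto simp: flaky_quantizer_def)
  have "u (Suc (Suc n)) = s * \<theta> * u n + (\<theta> - s) * u (Suc n) - \<beta> n"
    using gre by (simp add: leaky_gre_def s\<theta>)
  then have step: "u (Suc (Suc n)) + s * u (Suc n) = \<theta> * w - \<beta> n"
      "u (Suc (Suc n)) - \<theta> * u (Suc n) = - (s * z) - \<beta> n"
    by (simp_all add: w_def z_def algebra_simps)
  have "(9/10) * (1198/1000 + 1479/1000 * \<tau>) \<le> l1 * \<alpha>"
    using l1 \<alpha> \<tau> by (intro mult_mono) auto
  moreover have "l1 * \<alpha> \<le> 1 * (2053/1000 - 1058/1000 * \<tau>)"
    using l1 \<alpha> \<tau> by (intro mult_mono) auto
  ultimately have a: "107/100 + 133/100 * \<tau> \<le> l1 * \<alpha>" "l1 * \<alpha> \<le> 2053/1000 - 1058/1000 * \<tau>"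
    using \<tau> by simp_all
  have IH: "(\<theta> - 1) * w \<le> 1" "- 1 \<le> (\<theta> - 1) * w" "(1 - s) * \<bar>z\<bar> \<le> 1"
    using Suc \<theta> abs_le_iff[of "(\<theta> - 1) * w" 1] by (auto simp: w_def z_def abs_mult)
  have \<theta>w: "(\<theta> - 1) * (\<theta> * w) \<le> \<theta>" "- \<theta> \<le> (\<theta> - 1) * (\<theta> * w)"
    using mult_left_mono[OF IH(1), of \<theta>] mult_left_mono[OF IH(2), of \<theta>] \<theta>
    by (simp_all add: mult_ac)
  \<comment> \<open>Since \<open>\<theta> > 1\<close> expands \<open>w\<close>, the bound survives
    only through the choice of the bit. Subtracting the bit preserves one side by the induction
    hypothesis alone; \<open>leaky_gre_step\<close> supplies the other.\<close>
  have "\<bar>(\<theta> - 1) * (\<theta> * w - \<beta> n)\<bar> \<le> 1"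
    using bit
  proof
    assume b: "\<beta> n = 1"
    have "- \<tau> \<le> s * \<theta> * u n + (l1 * \<alpha>) * u (Suc n)"
      using quantizer b \<nu>[of n] unfolding flaky_quantizer_def s\<theta> mult.assoc mult.left_commute[of l1 \<alpha>]
      by simp
    then have "\<theta> - 2 \<le> (\<theta> - 1) * (\<theta> * w)"
      unfolding w_def using leaky_gre_step[OF \<theta> s \<tau> a] IH(3) by (simp add: z_def)
    then show ?thesis
      using \<theta>w b by (simp add: abs_le_iff right_diff_distrib)
  next
    assume b: "\<beta> n = -1"
    \<comment> \<open>The mirrored state reduces this bit to the previous case.\<close>
    have "- \<tau> \<le> s * \<theta> * (- u n) + (l1 * \<alpha>) * (- u (Suc n))"
      using quantizer b \<nu>[of n] unfolding flaky_quantizer_def s\<theta> mult.assoc mult.left_commute[of l1 \<alpha>]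
      by simp
    moreover have "(1 - s) * \<bar>- u (Suc n) - \<theta> * (- u n)\<bar> \<le> 1"
      using IH(3) by (simp add: z_def abs_minus_commute)
    ultimately have "\<theta> - 2 \<le> (\<theta> - 1) * (\<theta> * (- u (Suc n) + s * (- u n)))"
      by (intro leaky_gre_step[OF \<theta> s \<tau> a])
    also have "- u (Suc n) + s * (- u n) = - w"
      by (simp add: w_def)
    finally show ?thesis
      using \<theta>w b by (simp add: abs_le_iff distrib_left)
  qed
  \<comment> \<open>The factor \<open>- s\<close> contracts, so this bound holds for any choice of
    bits.\<close>
  moreover have "(1 - s) * \<bar>- (s * z) - \<beta> n\<bar> \<le> 1"
  proof -
    have "\<bar>- (s * z) - \<beta> n\<bar> \<le> s * \<bar>z\<bar> + 1"
      using bit s abs_triangle_ineq4[of "- (s * z)" "\<beta> n"] by (auto simp: abs_mult)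
    then have "(1 - s) * \<bar>- (s * z) - \<beta> n\<bar> \<le> (1 - s) * (s * \<bar>z\<bar> + 1)"
      using s by (intro mult_left_mono) auto
    also have "\<dots> = s * ((1 - s) * \<bar>z\<bar>) + (1 - s)"
      by (simp add: algebra_simps)
    also have "\<dots> \<le> s * 1 + (1 - s)"
      using IH(3) s by (intro add_right_mono mult_left_mono) auto
    finally show ?thesis
      by simp
  qed
  ultimately show ?case
    unfolding step using \<theta> by (simp add: abs_mult)
qed

section \<open>Size of the bit polynomial at the base\<close>

text \<open>For leakage parameters at most 1 and \<open>g < 0.618\<close>, the left side of the base
  equation is below \<open>0.618\<^sup>2 + 0.618 < 1\<close>. The constant lies just under the
  inverse golden ratio, the base without leakage.\<close>

lemma gre_base_ge:
  assumes "0 < l1" "l1 \<le> 1" "0 < l2" "l2 \<le> 1"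
  shows "309/500 \<le> gre_base l1 l2"
proof (rule ccontr)
  define g where "g = gre_base l1 l2"
  assume "\<not> ?thesis"
  then have "g < 309/500" by (simp add: g_def)
  have "0 < g" "l1 * l2 * g\<^sup>2 + l1 * g = 1"
    using gre_base_root[of l1 l2] assms by (auto simp: g_def)
  moreover have "g\<^sup>2 \<le> (309/500)\<^sup>2"
    using \<open>0 < g\<close> \<open>g < 309/500\<close> by (intro power_mono) auto
  moreover have "l1 * l2 * g\<^sup>2 \<le> 1 * 1 * g\<^sup>2" "l1 * g \<le> 1 * g"
    using assms \<open>0 < g\<close> by (intro mult_mono; simp)+
  ultimately show False
    using \<open>g < 309/500\<close> by (simp add: power_divide)
qed

lemma leaky_gre_partial_sum_le:
  assumes gre: "leaky_gre l1 l2 \<alpha> \<nu> 0 u \<beta>"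
    and l: "9/10 \<le> l1" "l1 \<le> 1" "9/10 \<le> l2" "l2 \<le> 1"
    and g: "g = gre_base l1 l2" "g \<le> 6491/10000"
    and \<tau>: "0 \<le> \<tau>" "\<tau> \<le> 337/1000" "\<And>k. \<nu> k \<le> \<tau>"
    and \<alpha>: "1198/1000 + 1479/1000 * \<tau> \<le> \<alpha>" "\<alpha> \<le> 2053/1000 - 1058/1000 * \<tau>"
  shows "\<bar>\<Sum>j\<le>n. \<beta> j * g ^ j\<bar> \<le> g ^ Suc n / (1 - g)"
proof -
  define s where "s = l1 * l2 * g"
  have g_ge: "309/500 \<le> g"
    using gre_base_ge[of l1 l2] l g by simp
  have root: "l1 * l2 * g\<^sup>2 + l1 * g = 1"
    using gre_base_root[of l1 l2] l g by simp
  then have sg: "s * g = 1 - l1 * g"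
    by (simp add: s_def power2_eq_square)
  then have "s * (1 / g) = l1 * l2" "1 / g - s = l1"
    using g_ge by (simp_all add: s_def field_simps)
  moreover have "77/50 \<le> 1 / g" "1 / g \<le> 8091/5000"
    using g g_ge by (simp_all add: field_simps)
  \<comment> \<open>The relation \<open>s = l2 * (l1 * g) = l2 * (1 - s * g)\<close> is
    self-correcting: too small an \<open>s\<close> makes the right side too large, and conversely
    for the upper bound.\<close>
  moreover have "14/25 \<le> s"
  proof (rule ccontr)
    assume "\<not> 14/25 \<le> s"
    moreover have "s * g \<le> 14/25 * (6491/10000)"
      using g g_ge l calculation by (intro mult_mono) auto
    moreover have "9/10 * (l1 * g) \<le> l2 * (l1 * g)"
      using l g_ge by (intro mult_right_mono) auto
    ultimately show False
      using sg by (simp add: s_def mult_ac)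
  qed
  moreover have "s \<le> 6181/10000"
  proof (rule ccontr)
    assume *: "\<not> s \<le> 6181/10000"
    then have "6181/10000 * (309/500) \<le> s * g"
      using g_ge by (intro mult_mono) auto
    moreover have "l2 * (l1 * g) \<le> 1 * (l1 * g)"
      using l g_ge by (intro mult_right_mono) auto
    ultimately show False
      using sg * by (simp add: s_def mult_ac)
  qed
  ultimately have "(1 / g - 1) * \<bar>u (Suc (Suc n)) + s * u (Suc n)\<bar> \<le> 1"
    using leaky_gre_bounded[OF gre l(1,2)] \<tau> \<alpha> by blast
  then have bd: "\<bar>u (Suc (Suc n)) + s * u (Suc n)\<bar> \<le> g / (1 - g)"
    using g g_ge by (simp add: field_simps)
  \<comment> \<open>The telescoped sum starts with exponent 1, hence the extra factor
    \<open>g\<close>, cancelled below.\<close>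
  have "g * (\<Sum>j\<le>n. \<beta> j * g ^ j) = (\<Sum>j<Suc n. \<beta> j * g ^ Suc j)"
    by (simp only: lessThan_Suc_atMost sum_distrib_left) (simp add: mult_ac)
  also have "\<dots> = - (g ^ Suc n) * (u (Suc (Suc n)) + s * u (Suc n))"
    using leaky_gre_sums[OF gre root, of "Suc n"] by (simp add: s_def)
  also have "\<dots> = g * (- (g ^ n) * (u (Suc (Suc n)) + s * u (Suc n)))"
    by simp
  finally have "(\<Sum>j\<le>n. \<beta> j * g ^ j) = - (g ^ n) * (u (Suc (Suc n)) + s * u (Suc n))"
    using g_ge by (subst (asm) mult_left_cancel) auto
  then have "\<bar>\<Sum>j\<le>n. \<beta> j * g ^ j\<bar> = g ^ n * \<bar>u (Suc (Suc n)) + s * u (Suc n)\<bar>"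
    using g_ge by (simp add: abs_mult)
  also have "\<dots> \<le> g ^ n * (g / (1 - g))"
    using bd g_ge by (intro mult_left_mono) auto
  finally show ?thesis
    by (simp add: mult_ac)
qed

section \<open>Existence, uniqueness and error of the root\<close>

theorem theorem1p2p8:
  fixes l1 l2 \<tau> \<alpha> \<gamma> \<gamma>high \<epsilon> \<delta> C1 :: real
    and \<nu> u \<beta> b :: "nat \<Rightarrow> real"
    and N :: int
  assumes "l1 \<in> {0.9..1}" and "l2 \<in> {0.9..1}"
    and "0 \<le> \<tau>" and "\<tau> \<le> 0.337"
    and "\<And>k. 0 \<le> \<nu> k \<and> \<nu> k \<le> \<tau>"
    and "\<alpha> \<in> {1.198 + 1.479 * \<tau> .. 2.053 - 1.058 * \<tau>}"
    and "leaky_gre l1 l2 \<alpha> \<nu> 0 u \<beta>"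
    and "\<And>j. j \<ge> 1 \<Longrightarrow> b j = \<beta> (j - 1)"
    and "\<gamma> = gre_base l1 l2"
    and "\<epsilon> > 0" and "\<gamma>high = 0.6491 - \<epsilon>" and "\<gamma> \<le> \<gamma>high"
    and "\<delta> > 0" and "delta_transversality \<delta> {0..\<gamma>high}"
    and "\<gamma> powi (N + 1) \<le> (1 - \<gamma>) * \<epsilon> * \<delta>"
    and "\<And>M::int. \<gamma> powi (M + 1) \<le> (1 - \<gamma>) * \<epsilon> * \<delta> \<Longrightarrow> N \<le> M"
    and "C1 = \<gamma> / (\<delta> * (1 - \<gamma>))"
  shows "\<forall>n::nat. int n \<ge> N \<longrightarrow>
           (\<exists>!t. t \<in> {0..0.6491} \<and> gre_poly b n t = 0) \<and>
           (\<forall>\<gamma>n. \<gamma>n \<in> {0..0.6491} \<and> gre_poly b n \<gamma>n = 0 \<longrightarrow> \<bar>\<gamma> - \<gamma>n\<bar> \<le> C1 * \<gamma> ^ n)"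
proof (intro allI impI)
  fix n :: nat
  assume nN: "N \<le> int n"
  have l: "9/10 \<le> l1" "l1 \<le> 1" "9/10 \<le> l2" "l2 \<le> 1"
    using assms(1,2) by simp_all
  have \<tau>: "0 \<le> \<tau>" "\<tau> \<le> 337/1000" "\<nu> k \<le> \<tau>" for k
    using assms(3-5) by simp_all
  have \<alpha>: "1198/1000 + 1479/1000 * \<tau> \<le> \<alpha>" "\<alpha> \<le> 2053/1000 - 1058/1000 * \<tau>"
    using assms(6) by simp_all
  have eps: "\<gamma> + \<epsilon> \<le> 6491/10000"
    using assms(11,12) by simp
  have \<gamma>: "309/500 \<le> \<gamma>" "\<gamma> \<le> 6491/10000"
    using gre_base_ge[of l1 l2] l assms(9) eps \<open>\<epsilon> > 0\<close> by simp_all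
  have "309/500 \<in> {0..\<gamma>high}"
    using \<gamma> assms(12) by simp
  then have \<delta>: "\<delta> \<le> 73/500"
    using delta_transversality_le assms(14) by blast
  have "\<epsilon> \<le> 311/10000"
    using eps \<gamma> by simp
  then have "\<epsilon> * \<delta> \<le> 311/10000 * (73/500)"
    using \<delta> \<open>\<delta> > 0\<close> by (intro mult_mono) auto
  then have ed: "\<epsilon> * \<delta> \<le> 23/5000"
    by simp
  have "\<gamma> ^ Suc n = \<gamma> powi (int n + 1)"
    by (metis of_nat_Suc power_int_of_nat add.commute)
  also have "\<dots> \<le> \<gamma> powi (N + 1)"
    using nN \<gamma> by (intro power_int_decreasing) auto
  finally have pow_le: "\<gamma> ^ Suc n \<le> (1 - \<gamma>) * (\<epsilon> * \<delta>)"
    using assms(15) by (simp add: mult_ac)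
  then have k_le: "\<gamma> ^ Suc n / (1 - \<gamma>) \<le> \<epsilon> * \<delta>"
    using \<gamma> by (simp add: pos_divide_le_eq mult.commute)
  \<comment> \<open>\<open>slope_bound\<close> needs this degree. A smaller \<open>n\<close> would
    give \<open>\<gamma> ^ Suc n\<close> at least \<open>0.618 ^ 5\<close>, about 0.09, far above
    \<open>\<epsilon> * \<delta> \<le> 0.0046\<close>.\<close>
  have "5 \<le> n"
  proof (rule ccontr)
    assume "\<not> 5 \<le> n"
    then have "\<gamma> ^ 5 \<le> \<gamma> ^ Suc n"
      using \<gamma> by (intro power_decreasing) auto
    moreover have "(309/500) ^ 5 \<le> \<gamma> ^ 5"
      using \<gamma> by (intro power_mono) auto
    moreover have "(1 - \<gamma>) * (\<epsilon> * \<delta>) \<le> 1 * (23/5000)"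
      using \<gamma> ed \<open>\<epsilon> > 0\<close> \<open>\<delta> > 0\<close> by (intro mult_mono) auto
    ultimately have "(309/500) ^ 5 \<le> (23/5000 :: real)"
      using pow_le by linarith
    then show False
      by (simp add: power_divide)
  qed
  \<comment> \<open>A global sign change affects neither the roots nor the modulus at
    \<open>\<gamma>\<close>.\<close>
  obtain c u' where gre: "leaky_gre l1 l2 \<alpha> \<nu> 0 u' c" and "c 0 = 1"
    and "c = \<beta> \<or> c = (\<lambda>j. - \<beta> j)"
  proof -
    have "\<beta> 0 = 1 \<or> - \<beta> 0 = 1"
      using assms(7) by (auto simp: leaky_gre_def flaky_quantizer_def)
    then show thesis
      using that[OF assms(7)] that[of "\<lambda>n. - u n" "\<lambda>n. - \<beta> n"] leaky_gre_uminus[OF assms(7)] by auto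
  qed
  define f where "f t = (\<Sum>j\<le>n. c j * t ^ j)" for t
  define f' where "f' t = (\<Sum>j\<le>n. c j * (real j * t ^ (j - 1)))" for t
  have poly: "gre_poly b n t = (\<Sum>j\<le>n. \<beta> j * t ^ j)" for t
    using assms(8) by (simp add: gre_poly_def sum.atMost_shift sum.atLeast1_atMost_eq)
  have poly_eq_0: "gre_poly b n t = 0 \<longleftrightarrow> f t = 0" for t
    using \<open>c = \<beta> \<or> c = (\<lambda>j. - \<beta> j)\<close> by (auto simp: poly f_def sum_negf)
  have deriv: "(f has_real_derivative f' x) (at x)" for x
    unfolding f_def f'_def by (auto intro!: derivative_eq_intros sum.cong)
  have "1198/1000 \<le> \<alpha>" "\<alpha> \<le> 2053/1000" "\<nu> k \<le> 337/1000" for k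
    using \<alpha> \<tau>(1,2) \<tau>(3)[of k] by linarith+
  then have bits: "c 1 = -1" "c 2 = -1" "c 3 = 1 \<or> c 3 = -1 \<and> c 4 = 1"
    using leaky_gre_initial_bits[OF gre l] \<open>c 0 = 1\<close> by auto
  have c_le: "\<bar>c j\<bar> \<le> 1" for j
    using gre by (auto simp: leaky_gre_def flaky_quantizer_def dest!: spec[of _ j])
  have neg: "f' x < - \<delta>" if x: "0 \<le> x" "x \<le> 0.6491" "f x \<le> \<epsilon> * \<delta>" for x
  proof -
    have "4/25 \<le> 5 * f x - x * f' x"
      unfolding f_def f'_def
      by (rule slope_bound) (use x \<open>5 \<le> n\<close> c_le \<open>c 0 = 1\<close> bits in auto)
    \<comment> \<open>Here 0.137 is 0.16 - 5 * 0.0046. A slope of at least \<open>- \<delta>\<close>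
      would instead give \<open>x * (- f' x)\<close> at most 0.6491 * 0.146, which is below
      0.095.\<close>
    then have *: "137/1000 \<le> x * (- f' x)"
      using x(3) ed by simp
    show ?thesis
    proof (rule ccontr)
      assume "\<not> f' x < - \<delta>"
      then have "- f' x \<le> 73/500"
        using \<delta> by linarith
      then have "x * (- f' x) \<le> 6491/10000 * (73/500)"
        using x(1,2) * mult_left_mono[of "- f' x" "73/500" x] by simp
      then show False
        using * by simp
    qed
  qed
  have f\<gamma>: "\<bar>f \<gamma>\<bar> \<le> \<gamma> ^ Suc n / (1 - \<gamma>)"
    unfolding f_def using leaky_gre_partial_sum_le[OF gre l assms(9) \<gamma>(2) \<tau> \<alpha>] .
  have "0 \<le> f 0"
    using \<open>c 0 = 1\<close> by (simp add: f_def power_0_left if_distrib sum.If_cases cong: if_cong)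
  \<comment> \<open>The margin \<open>\<epsilon>\<close> between \<open>\<gamma>high\<close> and
    0.6491 is the room needed to reach a root to the right of \<open>\<gamma>\<close>.\<close>
  have "\<gamma> ^ Suc n / (1 - \<gamma>) / \<delta> \<le> \<epsilon>"
    using k_le \<open>\<delta> > 0\<close> by (simp only: pos_divide_le_eq)
  then have "\<gamma> + \<gamma> ^ Suc n / (1 - \<gamma>) / \<delta> \<le> \<gamma> + \<epsilon>"
    by simp
  also have "\<dots> \<le> 0.6491"
    using eps by simp
  finally have end_le: "\<gamma> + \<gamma> ^ Suc n / (1 - \<gamma>) / \<delta> \<le> 0.6491" .
  have "0 \<le> \<gamma>"
    using \<gamma> by simp
  note root = transversal_root[OF deriv neg \<open>\<delta> > 0\<close> \<open>0 \<le> f 0\<close> \<open>0 \<le> \<gamma>\<close> f\<gamma> k_le end_le]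
  have "\<gamma> ^ Suc n / (1 - \<gamma>) / \<delta> = C1 * \<gamma> ^ n"
    by (simp add: assms(17) mult_ac)
  then show "(\<exists>!t. t \<in> {0..0.6491} \<and> gre_poly b n t = 0) \<and>
      (\<forall>\<gamma>n. \<gamma>n \<in> {0..0.6491} \<and> gre_poly b n \<gamma>n = 0 \<longrightarrow> \<bar>\<gamma> - \<gamma>n\<bar> \<le> C1 * \<gamma> ^ n)"
    unfolding poly_eq_0 using root by auto
qed

end
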